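(* Let $r \geq 2$ be an integer. Let $m \geq 2$ and let $A=\{a_1, a_2, \dots, a_m\}$ be a set of integers with $a_1 < a_2 < \cdots < a_m$. Set $$d=\gcd(a_2-a_1, a_3-a_1, \dots, a_m-a_1).$$ Then the asymptotic $r$-covering number $\tilde{C}_r(A)$ satisfies $$\tilde{C}_r(A) = \begin{cases} r & \text{if } a_2=a_1+d \text{ and } a_m=a_{m-1}+d,\\ r+1 & \text{otherwise.}\end{cases}$$
   Context: For nonempty sets $S,T$ of integers, $S+T=\{s+t \mid s\in S,\ t\in T\}$. For a positive integer $h$ and a nonempty set $A$ of integers, the $h$-fold sumset is $hA=\{x_1+\cdots+x_h \mid x_i\in A \text{ for } i=1,\dots,h\}$ (repetitions allowed). For positive integers $r$ and $l$, a nonempty finite set $A$ of integers is an $(r,l)$-approximate group if there exists a set $X$ consisting of $l$ integers such that $rA \subseteq A+X$. The set $A$ is an asymptotic $(r,l)$-approximate group if there is an integer $h_0$ such that $hA$ is an $(r,l)$-approximate group for every positive integer $h\geq h_0$. The asymptotic $r$-covering number $\tilde{C}_r(A)$ is the smallest positive integer $l$ for which $A$ is an asymptotic $(r,l)$-approximate group. *)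

theory Defs
  imports Main "HOL-Library.Set_Algebras"
begin

definition hfold_sumset :: "nat \<Rightarrow> int set \<Rightarrow> int set" where
  "hfold_sumset h A = {(\<Sum>i<h. x i) | x. \<forall>i<h. x i \<in> A}"

text \<open>Below, \<open>+\<close> on sets is elementwise addition.\<close>

definition approximate_group :: "nat \<Rightarrow> nat \<Rightarrow> int set \<Rightarrow> bool" where
  "approximate_group r l A \<longleftrightarrow>
     r > 0 \<and> l > 0 \<and> finite A \<and> A \<noteq> {} \<and>
     (\<exists>X. finite X \<and> card X = l \<and> hfold_sumset r A \<subseteq> A + X)"

definition asymptotic_approximate_group :: "nat \<Rightarrow> nat \<Rightarrow> int set \<Rightarrow> bool" where
  "asymptotic_approximate_group r l A \<longleftrightarrow>
     (\<exists>h0. \<forall>h\<ge>h0. h > 0 \<longrightarrow> approximate_group r l (hfold_sumset h A))"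

text \<open>This is meaningful only when \<open>A\<close> is an asymptotic \<open>(r,l)\<close>-approximate group
  for some \<open>l\<close>; otherwise the value of \<open>LEAST\<close> is unspecified.\<close>

definition asymptotic_covering_number :: "nat \<Rightarrow> int set \<Rightarrow> nat" where
  "asymptotic_covering_number r A =
     (LEAST l. l > 0 \<and> asymptotic_approximate_group r l A)"

end

theory Submission imports Defs
begin

text \<open>
  Covering numbers do not change under \<open>x \<mapsto> u + v * x\<close> with \<open>v \<noteq> 0\<close>, so \<open>A\<close> may be replaced by
  \<open>B = {(x - a\<^sub>1) / d | x \<in> A}\<close>, whose least element is 0, whose largest is some \<open>k\<close>, and whose
  gcd is 1. The reflection \<open>x \<mapsto> k - x\<close> is another such map, and it exchanges the two ends
  of \<open>B\<close>.

  The sumset \<open>hB\<close> lies in \<open>[0, hk]\<close> and fills all of it except for two ends of bounded length: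
  there is a \<open>c\<close> independent of \<open>h\<close> with \<open>[c, hk - c] \<subseteq> hB\<close> (lemma \<open>central_interval\<close>). Near 0
  the sets \<open>hB\<close> and \<open>rhB\<close> agree once \<open>h\<close> is large (\<open>small_mem\<close>), and so they do at the top ends
  by reflection. Write \<open>H = hk\<close>.

  Upper bounds. A copy of \<open>hB\<close> placed at 0 and one placed at \<open>(r - 1) H\<close> cover the ends of
  \<open>rhB\<close>. The total length is only \<open>r H\<close>, so adding \<open>r - 1\<close> copies whose central intervals
  overlap suffices for the rest, which gives \<open>r + 1\<close> translates. If \<open>1\<close> and \<open>k - 1\<close> are in \<open>B\<close>,
  then \<open>hB\<close> has no gaps at all, and \<open>r\<close> copies of \<open>[0, H]\<close> cover \<open>[0, r H]\<close>.

  Lower bounds (\<open>cover_card_lower_bound\<close>). The \<open>r\<close> points \<open>c + j (H + 1)\<close> lie in \<open>rhB\<close> but are too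
  far apart for any translate of \<open>hB\<close> to contain two of them, so \<open>r\<close> translates are needed.
  Suppose that there are exactly \<open>r\<close>, starting at \<open>x\<^sub>0 < \<dots> < x\<^bsub>r-1\<^esub>\<close>. Covering the end points
  forces \<open>x\<^sub>0 \<le> 0\<close> and \<open>x\<^bsub>r-1\<^esub> \<ge> (r - 1) H\<close>, so two consecutive translates start at distance at least
  \<open>H\<close>. Then the point \<open>x\<^bsub>i+1\<^esub> + 1\<close> is beyond the earlier of the two, and for a suitable such pair
  all further translates miss it as well. It can only be covered by the later one, so \<open>1 \<in> hB\<close>
  and hence \<open>1 \<in> B\<close>. By reflection also \<open>k - 1 \<in> B\<close>.

  Finally, as \<open>d\<close> divides all differences, \<open>1 \<in> B\<close> and \<open>k - 1 \<in> B\<close> say that the first and the last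
  gaps of \<open>A\<close> equal \<open>d\<close>.
\<close>

section \<open>Iterated sumsets\<close>

lemma hfold_sumset_0 [simp]: "hfold_sumset 0 A = {0}"
  by (auto simp: hfold_sumset_def)

lemma hfold_sumset_Suc: "hfold_sumset (Suc h) A = hfold_sumset h A + A"
proof (intro equalityI subsetI)
  fix z assume "z \<in> hfold_sumset (Suc h) A"
  then obtain x where x: "z = (\<Sum>i<Suc h. x i)" "\<forall>i<Suc h. x i \<in> A"
    unfolding hfold_sumset_def by blast
  have "(\<Sum>i<h. x i) \<in> hfold_sumset h A"
    using x(2) unfolding hfold_sumset_def by auto
  with x show "z \<in> hfold_sumset h A + A"
    by (auto intro: set_plus_intro)
next
  fix z assume "z \<in> hfold_sumset h A + A"
  then obtain x b where x: "z = (\<Sum>i<h. x i) + b" "\<forall>i<h. x i \<in> A" "b \<in> A"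
    unfolding hfold_sumset_def set_plus_def by blast
  have "z = (\<Sum>i<Suc h. (x(h := b)) i)" "\<forall>i<Suc h. (x(h := b)) i \<in> A"
    using x by (auto simp: less_Suc_eq)
  then show "z \<in> hfold_sumset (Suc h) A"
    unfolding hfold_sumset_def by blast
qed

lemma hfold_sumset_1 [simp]: "hfold_sumset (Suc 0) A = A"
  by (simp add: hfold_sumset_Suc set_plus_def)

lemma hfold_sumset_add: "hfold_sumset (g + h) A = hfold_sumset g A + hfold_sumset h A"
proof (induction h)
  case 0
  show ?case by (auto simp: set_plus_def)
next
  case (Suc h)
  then show ?case by (simp add: hfold_sumset_Suc add.assoc)
qed

lemma hfold_sumset_hfold_sumset:
  "hfold_sumset r (hfold_sumset h A) = hfold_sumset (r * h) A"
  by (induction r) (simp_all add: hfold_sumset_Suc hfold_sumset_add add.commute)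

lemma finite_hfold_sumset: "finite A \<Longrightarrow> finite (hfold_sumset h A)"
  by (induction h) (simp_all add: hfold_sumset_Suc finite_set_plus)

lemma hfold_sumset_nonempty: "A \<noteq> {} \<Longrightarrow> hfold_sumset h A \<noteq> {}"
  by (induction h) (auto simp: hfold_sumset_Suc set_plus_def)

lemma hfold_sumset_affine:
  "hfold_sumset h ((\<lambda>x. u + v * x) ` A) = (\<lambda>x. int h * u + v * x) ` hfold_sumset h A"
proof (induction h)
  case (Suc h)
  have "(\<lambda>x. int h * u + v * x) ` S + (\<lambda>x. u + v * x) ` A
      = (\<lambda>x. int (Suc h) * u + v * x) ` (S + A)" for S
  proof (intro equalityI subsetI)
    fix z assume "z \<in> (\<lambda>x. int h * u + v * x) ` S + (\<lambda>x. u + v * x) ` A"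
    then obtain s b where "s \<in> S" "b \<in> A" "z = (int h * u + v * s) + (u + v * b)"
      by (auto simp: set_plus_def)
    then show "z \<in> (\<lambda>x. int (Suc h) * u + v * x) ` (S + A)"
      by (intro image_eqI[of _ _ "s + b"]) (auto simp: algebra_simps)
  next
    fix z assume "z \<in> (\<lambda>x. int (Suc h) * u + v * x) ` (S + A)"
    then obtain s b where sb: "s \<in> S" "b \<in> A" "z = int (Suc h) * u + v * (s + b)"
      by (auto simp: set_plus_def)
    have "(int h * u + v * s) + (u + v * b) \<in> (\<lambda>x. int h * u + v * x) ` S + (\<lambda>x. u + v * x) ` A"
      using sb by (intro set_plus_intro imageI)
    with sb(3) show "z \<in> (\<lambda>x. int h * u + v * x) ` S + (\<lambda>x. u + v * x) ` A"
      by (simp add: algebra_simps)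
  qed
  with Suc show ?case by (simp add: hfold_sumset_Suc)
qed auto

section \<open>Covering by translates and affine invariance\<close>

text \<open>Superfluous translates do no harm, and there are infinitely many integers to pad a small
  covering set with.\<close>

lemma approximate_group_iff_card_le:
  "approximate_group r l A \<longleftrightarrow> r > 0 \<and> l > 0 \<and> finite A \<and> A \<noteq> {} \<and>
     (\<exists>X. finite X \<and> card X \<le> l \<and> hfold_sumset r A \<subseteq> A + X)"
proof -
  have "\<exists>Y. finite Y \<and> card Y = l \<and> hfold_sumset r A \<subseteq> A + Y"
    if "finite X" "card X \<le> l" "hfold_sumset r A \<subseteq> A + X" for X
  proof -
    have "infinite (UNIV - X)" using that(1) by (intro Diff_infinite_finite infinite_UNIV_int)
    from infinite_arbitrarily_large[OF this]
    obtain Z where Z: "finite Z" "card Z = l - card X" "Z \<subseteq> UNIV - X" by blast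
    then have "X \<inter> Z = {}" by blast
    then have "finite (X \<union> Z)" "card (X \<union> Z) = l"
      using that(1,2) Z(1,2) by (simp_all add: card_Un_disjoint)
    moreover have "hfold_sumset r A \<subseteq> A + (X \<union> Z)"
      using that(3) set_plus_mono2[of A A X "X \<union> Z"] by blast
    ultimately show ?thesis by blast
  qed
  then show ?thesis unfolding approximate_group_def by (metis order_refl)
qed

text \<open>The dilated set is covered by the correspondingly dilated and shifted translates. Conversely, a
  translation by \<open>x\<close> that covers some point of the image has \<open>x \<equiv> (r - 1) u\<close> modulo \<open>v\<close>, so dividing
  by \<open>v\<close> recovers a covering of the original set.\<close>

lemma approximate_group_affine:
  fixes u v :: int
  assumes "v \<noteq> 0"
  shows "approximate_group r l ((\<lambda>x. u + v * x) ` S) \<longleftrightarrow> approximate_group r l S"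
proof -
  have fin: "finite ((\<lambda>x. u + v * x) ` S) \<longleftrightarrow> finite S"
    using assms by (intro finite_image_iff) (auto simp: inj_on_def)
  have cover: "(\<exists>X. finite X \<and> card X \<le> l \<and> hfold_sumset r ((\<lambda>x. u + v * x) ` S)
        \<subseteq> (\<lambda>x. u + v * x) ` S + X)
      \<longleftrightarrow> (\<exists>X. finite X \<and> card X \<le> l \<and> hfold_sumset r S \<subseteq> S + X)"
    (is "?L \<longleftrightarrow> ?R")
  proof
    assume ?L
    then obtain X where X: "finite X" "card X \<le> l"
      "(\<lambda>x. int r * u + v * x) ` hfold_sumset r S \<subseteq> (\<lambda>x. u + v * x) ` S + X"
      unfolding hfold_sumset_affine by blast
    define f where "f x = (x - (int r - 1) * u) div v" for x
    have "z \<in> S + f ` X" if "z \<in> hfold_sumset r S" for z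
    proof -
      have "int r * u + v * z \<in> (\<lambda>x. u + v * x) ` S + X" using X(3) that by blast
      then obtain s x where sx: "s \<in> S" "x \<in> X" "int r * u + v * z = (u + v * s) + x"
        by (auto simp: set_plus_def)
      then have "x - (int r - 1) * u = v * (z - s)" by (simp add: algebra_simps)
      then have "z = s + f x" using assms by (simp add: f_def)
      with sx show ?thesis by auto
    qed
    moreover have "card (f ` X) \<le> l" using X card_image_le order_trans by blast
    ultimately show ?R using X(1) by blast
  next
    assume ?R
    then obtain X where X: "finite X" "card X \<le> l" "hfold_sumset r S \<subseteq> S + X"
      by blast
    define f where "f x = (int r - 1) * u + v * x" for x
    have "int r * u + v * z \<in> (\<lambda>x. u + v * x) ` S + f ` X"
      if "z \<in> hfold_sumset r S" for z
    proof -
      have "z \<in> S + X" using X(3) that by blast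
      then obtain s x where sx: "s \<in> S" "x \<in> X" "z = s + x"
        by (auto simp: set_plus_def)
      then have "int r * u + v * z = (u + v * s) + f x"
        by (simp add: f_def algebra_simps)
      with sx show ?thesis by auto
    qed
    moreover have "card (f ` X) \<le> l" using X card_image_le order_trans by blast
    ultimately show ?L using X(1) unfolding hfold_sumset_affine by blast
  qed
  show ?thesis unfolding approximate_group_iff_card_le cover fin by simp
qed

lemma asymptotic_approximate_group_affine:
  fixes u v :: int
  assumes "v \<noteq> 0"
  shows "asymptotic_approximate_group r l ((\<lambda>x. u + v * x) ` S)
    \<longleftrightarrow> asymptotic_approximate_group r l S"
  unfolding asymptotic_approximate_group_def hfold_sumset_affine
  by (simp add: approximate_group_affine assms)

section \<open>Sumsets of normalized sets\<close>

lemma of_nat_mult_mem_of_add_closed: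
  fixes G :: "int set"
  assumes "0 \<in> G" "\<And>x y. x \<in> G \<Longrightarrow> y \<in> G \<Longrightarrow> x + y \<in> G" "x \<in> G"
  shows "int n * x \<in> G"
  by (induction n) (use assms in \<open>auto simp: algebra_simps\<close>)

lemma Gcd_mem_of_add_uminus_closed:
  fixes G B :: "int set"
  assumes "finite B" "B \<subseteq> G" "0 \<in> G"
    and add: "\<And>x y. x \<in> G \<Longrightarrow> y \<in> G \<Longrightarrow> x + y \<in> G"
    and neg: "\<And>x. x \<in> G \<Longrightarrow> - x \<in> G"
  shows "Gcd B \<in> G"
proof -
  have mult: "u * x \<in> G" if "x \<in> G" for u x
    using of_nat_mult_mem_of_add_closed[OF assms(3) add that, of "nat \<bar>u\<bar>"] neg[of "\<bar>u\<bar> * x"]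
    by (cases "u \<ge> 0") auto
  show ?thesis using assms(1,2)
  proof (induction B)
    case (insert b B)
    obtain u v where "u * b + v * Gcd B = gcd b (Gcd B)" using bezout_int by blast
    with insert add mult show ?case by (metis Gcd_insert insert_subset)
  qed (use assms in auto)
qed

locale normalized_set =
  fixes B :: "int set" and k :: int
  assumes subset: "B \<subseteq> {0..k}"
    and zero_mem: "0 \<in> B"
    and top_mem: "k \<in> B"
    and k_pos: "k > 0"
    and Gcd_eq_1: "Gcd B = 1"
begin

lemma finite_B: "finite B"
  using subset finite_subset by blast

lemma hfold_subset: "hfold_sumset h B \<subseteq> {0..int h * k}"
proof (induction h)
  case (Suc h)
  show ?case
    using Suc subset by (fastforce simp: hfold_sumset_Suc set_plus_def algebra_simps)
qed auto

lemma hfold_mono: "g \<le> h \<Longrightarrow> hfold_sumset g B \<subseteq> hfold_sumset h B"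
proof (induction h rule: dec_induct)
  case (step h)
  then show ?case using zero_mem set_plus_intro[of _ "hfold_sumset h B" 0 B]
    by (auto simp: hfold_sumset_Suc)
qed auto

lemma add_multiple_mem:
  "z \<in> hfold_sumset g B \<Longrightarrow> z + int j * k \<in> hfold_sumset (g + j) B"
proof (induction j)
  case (Suc j)
  have "(z + int j * k) + k \<in> hfold_sumset (Suc (g + j)) B"
    unfolding hfold_sumset_Suc using Suc top_mem by (intro set_plus_intro)
  then show ?case by (simp add: algebra_simps)
qed auto

text \<open>A sum of nonnegative integers that equals \<open>z\<close> has at most \<open>z\<close> nonzero summands, and zero
  summands can be dropped or added freely.\<close>

lemma small_mem:
  "z \<in> hfold_sumset g B \<Longrightarrow> z \<le> int h \<Longrightarrow> z \<in> hfold_sumset h B"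
proof (induction g arbitrary: z h)
  case 0
  then show ?case using hfold_mono[of 0 h] by auto
next
  case (Suc g)
  then obtain y b where yb: "y \<in> hfold_sumset g B" "b \<in> B" "z = y + b"
    by (auto simp: hfold_sumset_Suc set_plus_def)
  show ?case
  proof (cases "b = 0")
    case True
    with yb Suc show ?thesis by simp
  next
    case False
    have "y \<ge> 0" "b \<ge> 1" using yb hfold_subset subset False by fastforce+
    with yb Suc.prems obtain h' where h': "h = Suc h'" "y \<le> int h'"
      by (cases h) auto
    with Suc.IH yb have "y \<in> hfold_sumset h' B" by blast
    with yb h' show ?thesis by (auto simp: hfold_sumset_Suc)
  qed
qed

text \<open>Every statement about the lower end of \<open>B\<close> can be transferred to the upper end by
  applying it to the reflected set.\<close>

lemma reflected: "normalized_set ((\<lambda>x. k - x) ` B) k"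
proof
  show "(\<lambda>x. k - x) ` B \<subseteq> {0..k}" using subset by auto
  show "0 \<in> (\<lambda>x. k - x) ` B" using top_mem by force
  show "k \<in> (\<lambda>x. k - x) ` B" using zero_mem by force
  show "k > 0" by (rule k_pos)
  have "Gcd ((\<lambda>x. k - x) ` B) dvd b" if "b \<in> B" for b
  proof -
    have "Gcd ((\<lambda>x. k - x) ` B) dvd k - b" using that by auto
    moreover have "Gcd ((\<lambda>x. k - x) ` B) dvd k - 0"
      using zero_mem by (intro Gcd_dvd) blast
    ultimately have "Gcd ((\<lambda>x. k - x) ` B) dvd (k - 0) - (k - b)" by (rule dvd_diff[rotated])
    then show ?thesis by simp
  qed
  then have "Gcd ((\<lambda>x. k - x) ` B) dvd Gcd B" by (intro Gcd_greatest) auto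
  then show "Gcd ((\<lambda>x. k - x) ` B) = 1" unfolding Gcd_eq_1
    by (simp add: abs_Gcd_eq zdvd1_eq)
qed

lemma reflected_affine: "(\<lambda>x. k - x) ` B = (\<lambda>x. k + (- 1) * x) ` B"
  by simp

lemma hfold_reflected:
  "z \<in> hfold_sumset h ((\<lambda>x. k - x) ` B) \<longleftrightarrow> int h * k - z \<in> hfold_sumset h B"
  unfolding reflected_affine hfold_sumset_affine
  by (auto intro!: image_eqI[of _ _ "int h * k - z"])

lemma large_mem:
  assumes "int g * k - z \<in> hfold_sumset g B" "z \<le> int h"
  shows "int h * k - z \<in> hfold_sumset h B"
  using normalized_set.small_mem[OF reflected, of z g h] assms
  unfolding hfold_reflected by simp

text \<open>Since \<open>B\<close> has gcd 1, its sums meet every residue class modulo \<open>k\<close>, and finitely many classes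
  are met within a single sumset \<open>N B\<close>. From an element of \<open>N B\<close> in the class of \<open>z\<close>, which
  is at most \<open>N k\<close>, the remaining \<open>h - N\<close> summands climb to \<open>z\<close> in steps of \<open>k\<close>.\<close>

lemma central_interval:
  obtains c where "c \<ge> 0" "\<And>h. {c..int h * k - c} \<subseteq> hfold_sumset h B"
proof -
  \<comment> \<open>The integers congruent to a sum of elements of \<open>B\<close>; they form a subgroup, because
    modulo \<open>k\<close> the negative of a sum is its \<open>(k - 1)\<close>-fold multiple.\<close>
  define G where "G = {z. \<exists>g. \<exists>n \<in> hfold_sumset g B. n mod k = z mod k}"
  have add: "x + y \<in> G" if xy: "x \<in> G" "y \<in> G" for x y
  proof -
    obtain g n g' n' where *: "n \<in> hfold_sumset g B" "n mod k = x mod k"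
      "n' \<in> hfold_sumset g' B" "n' mod k = y mod k"
      using xy unfolding G_def by blast
    then have "n + n' \<in> hfold_sumset (g + g') B" "(n + n') mod k = (x + y) mod k"
      by (auto simp: hfold_sumset_add intro: mod_add_cong)
    then show ?thesis unfolding G_def by blast
  qed
  have G0: "0 \<in> G" unfolding G_def by (auto intro: exI[of _ 0])
  have B_G: "B \<subseteq> G"
    unfolding G_def by (auto intro!: exI[of _ "Suc 0"])
  have nat_mult: "int n * x \<in> G" if "x \<in> G" for n x
    by (rule of_nat_mult_mem_of_add_closed[OF G0 add that])
  have neg: "- x \<in> G" if "x \<in> G" for x
  proof -
    have "int (nat (k - 1)) * x \<in> G" by (rule nat_mult[OF that])
    moreover have "(int (nat (k - 1)) * x) mod k = (- x) mod k"
    proof -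
      have "int (nat (k - 1)) * x = - x + k * x" using k_pos by (simp add: algebra_simps)
      then show ?thesis by (simp only: mod_mult_self2)
    qed
    ultimately show ?thesis unfolding G_def by simp
  qed
  have "1 \<in> G"
    using Gcd_mem_of_add_uminus_closed[OF finite_B B_G G0 add neg] Gcd_eq_1 by simp
  then have "int s \<in> G" for s using nat_mult[of 1 s] by simp
  then have "\<forall>s. \<exists>g. \<exists>n \<in> hfold_sumset g B. n mod k = int s mod k"
    unfolding G_def by blast
  then obtain g n where gn: "\<And>s. n s \<in> hfold_sumset (g s) B" "\<And>s. n s mod k = int s mod k"
    by metis
  define N where "N = Max (g ` {..nat k})"
  have nN: "n s \<in> hfold_sumset N B" if "s \<le> nat k" for s
  proof -
    have "g s \<le> N" unfolding N_def using that by (intro Max_ge) auto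
    with gn(1) hfold_mono show ?thesis by blast
  qed
  show ?thesis
  proof
    show "int N * k \<ge> 0" using k_pos by simp
    fix h
    show "{int N * k..int h * k - int N * k} \<subseteq> hfold_sumset h B"
    proof
      fix z assume z: "z \<in> {int N * k..int h * k - int N * k}"
      define s where "s = nat (z mod k)"
      have s: "int s = z mod k" "s \<le> nat k" using k_pos by (auto simp: s_def nat_mono less_imp_le)
      have ns: "n s \<in> hfold_sumset N B" by (rule nN[OF s(2)])
      have "z mod k = n s mod k" using gn(2)[of s] s(1) by simp
      then obtain q where q: "z = n s + k * q" by (metis mod_eqE diff_add_cancel add.commute mod_eq_dvd_iff dvd_def)
      have ns_le: "0 \<le> n s" "n s \<le> int N * k" using ns hfold_subset by fastforce+
      have "k * q \<ge> 0" using z q ns_le by auto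
      then have q0: "q \<ge> 0" using k_pos by (simp add: zero_le_mult_iff)
      have "k * q \<le> k * (int h - int N)" using z q ns_le by (simp add: algebra_simps)
      then have qh: "q \<le> int h - int N" using k_pos by simp
      have "n s + int (nat q) * k \<in> hfold_sumset (N + nat q) B" by (rule add_multiple_mem[OF ns])
      moreover have "N + nat q \<le> h" using q0 qh by auto
      ultimately show "z \<in> hfold_sumset h B"
        using hfold_mono q q0 by (auto simp: mult.commute)
    qed
  qed
qed

section \<open>Upper bounds\<close>

lemma approximate_group_hfoldI:
  assumes "r > 0" "l > 0" "finite X" "card X \<le> l"
    and cover: "\<And>z. z \<in> hfold_sumset (r * h) B \<Longrightarrow> \<exists>x\<in>X. z - x \<in> hfold_sumset h B"
  shows "approximate_group r l (hfold_sumset h B)"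
proof -
  have "z \<in> hfold_sumset h B + X" if z: "z \<in> hfold_sumset (r * h) B" for z
  proof -
    obtain x where "x \<in> X" "z - x \<in> hfold_sumset h B" using cover[OF z] by blast
    then show ?thesis using set_plus_intro[of "z - x" _ x X] by simp
  qed
  then have "hfold_sumset (r * h) B \<subseteq> hfold_sumset h B + X" by blast
  moreover have "finite (hfold_sumset h B)" by (rule finite_hfold_sumset[OF finite_B])
  moreover have "hfold_sumset h B \<noteq> {}" using zero_mem by (intro hfold_sumset_nonempty) auto
  ultimately show ?thesis
    unfolding approximate_group_iff_card_le hfold_sumset_hfold_sumset using assms(1-4) by blast
qed

text \<open>The central intervals, of length \<open>H - 2 c\<close>, of \<open>r\<close> copies placed at steps of \<open>L = H - 2 c\<close> leave
  no gap. The total loss of \<open>2 r c\<close> is bounded, so for large \<open>H\<close> they reach the central interval of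
  one more copy, whose top end is aligned with the top end of \<open>rhB\<close>.\<close>

lemma asymptotic_Suc_r:
  assumes "r > 0"
  shows "asymptotic_approximate_group r (r + 1) B"
proof -
  obtain c where c: "c \<ge> 0" "\<And>h. {c..int h * k - c} \<subseteq> hfold_sumset h B"
    using central_interval by blast
  show ?thesis unfolding asymptotic_approximate_group_def
  proof (intro exI allI impI)
    fix h :: nat
    assume h: "h \<ge> nat (c + 1 + 2 * c * (int r + 1))" "h > 0"
    define H where "H = int h * k"
    define L where "L = H - 2 * c"
    have "2 * c * (int r + 1) \<ge> 0" using c by simp
    with h have hc: "c \<le> int h" and "int h > 2 * c * (int r + 1)"
      using c(1) by linarith+
    moreover have "H \<ge> int h" using k_pos by (simp add: H_def mult_le_cancel_left1)
    ultimately have H: "H > 2 * c * int r + 2 * c" by (simp add: algebra_simps)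
    then have L: "L > 0" using c by (simp add: L_def) (smt (verit) mult_nonneg_nonneg of_nat_0_le_iff)
    define X where "X = insert ((int r - 1) * H) ((\<lambda>j. int j * L) ` {..<r})"
    have "card X \<le> r + 1" unfolding X_def
      using card_image_le[of "{..<r}" "\<lambda>j. int j * L"]
      by (simp add: card_insert_if)
    moreover have "\<exists>x\<in>X. z - x \<in> hfold_sumset h B" if z: "z \<in> hfold_sumset (r * h) B" for z
    proof -
      consider "z \<le> c" | "z \<ge> int r * H - c" | "c \<le> z" "z \<le> int r * H - c" "z \<ge> (int r - 1) * H + c"
        | "c \<le> z" "z \<le> (int r - 1) * H + c"
        by linarith
      then show ?thesis
      proof cases
        case 1
        then have "z - int 0 * L \<in> hfold_sumset h B" using small_mem[OF z] hc by simp
        then show ?thesis using assms unfolding X_def by blast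
      next
        case 2
        have rH: "int (r * h) * k = int r * H" by (simp add: H_def)
        have "int (r * h) * k - (int (r * h) * k - z) \<in> hfold_sumset (r * h) B" using z by simp
        from large_mem[OF this, of h] 2 hc have "H - (int r * H - z) \<in> hfold_sumset h B"
          unfolding rH H_def by simp
        then have "z - (int r - 1) * H \<in> hfold_sumset h B" by (simp add: algebra_simps)
        then show ?thesis unfolding X_def by blast
      next
        case 3
        then have "z - (int r - 1) * H \<in> {c..H - c}" by (auto simp: algebra_simps)
        then have "z - (int r - 1) * H \<in> hfold_sumset h B" using c(2) unfolding H_def by blast
        then show ?thesis unfolding X_def by blast
      next
        case 4
        define j where "j = nat ((z - c) div L)"
        have j: "int j = (z - c) div L" using 4 L by (simp add: j_def pos_imp_zdiv_nonneg_iff)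
        have zj: "z - c = int j * L + (z - c) mod L" using j by simp
        have m: "0 \<le> (z - c) mod L" "(z - c) mod L < L" using L by simp_all
        have "j < r"
        proof (rule ccontr)
          assume "\<not> j < r"
          then have "int r * L \<le> int j * L" using L by simp
          with zj m 4 have "int r * L \<le> (int r - 1) * H" by linarith
          with H c show False by (simp add: L_def algebra_simps)
        qed
        have "z - int j * L \<in> {c..H - c}" using zj m by (simp add: L_def)
        then have "z - int j * L \<in> hfold_sumset h B" using c(2) unfolding H_def by blast
        with \<open>j < r\<close> show ?thesis unfolding X_def by blast
      qed
    qed
    moreover have "finite X" by (simp add: X_def)
    ultimately show "approximate_group r (r + 1) (hfold_sumset h B)"
      using assms(1) by (intro approximate_group_hfoldI[of r _ X]) auto
  qed
qed

lemma initial_interval: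
  assumes "1 \<in> B" "z \<ge> 0" "z \<le> int h"
  shows "z \<in> hfold_sumset h B"
proof -
  have "int n \<in> hfold_sumset n B" for n
  proof (induction n)
    case (Suc n)
    then have "int n + 1 \<in> hfold_sumset (Suc n) B"
      unfolding hfold_sumset_Suc using assms by (intro set_plus_intro)
    then show ?case by (simp add: add.commute)
  qed simp
  from this[of "nat z"] show ?thesis using assms hfold_mono[of "nat z" h] by (auto simp: nat_le_iff)
qed

text \<open>With 1 and \<open>k - 1\<close> in \<open>B\<close>, the sums of ones fill the lower end of \<open>hB\<close>, and by reflection the
  upper end is filled as well, so \<open>hB = [0, H]\<close>.\<close>

lemma asymptotic_r:
  assumes "r > 0" and ends: "1 \<in> B" "k - 1 \<in> B"
  shows "asymptotic_approximate_group r r B"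
proof -
  obtain c where c: "c \<ge> 0" "\<And>h. {c..int h * k - c} \<subseteq> hfold_sumset h B"
    using central_interval by blast
  have end': "1 \<in> (\<lambda>x. k - x) ` B" using ends(2) by force
  show ?thesis unfolding asymptotic_approximate_group_def
  proof (intro exI allI impI)
    fix h :: nat
    assume h: "h \<ge> nat c" "h > 0"
    define H where "H = int h * k"
    have Hpos: "H > 0" using h k_pos by (simp add: H_def)
    have full: "z \<in> hfold_sumset h B" if z: "0 \<le> z" "z \<le> H" for z
    proof -
      consider "z \<le> c" | "H - z \<le> c" | "c \<le> z" "z \<le> H - c" by linarith
      then show ?thesis
      proof cases
        case 1
        with initial_interval ends z h show ?thesis by auto
      next
        case 2
        then have "H - z \<in> hfold_sumset h ((\<lambda>x. k - x) ` B)"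
          using normalized_set.initial_interval[OF reflected end'] z h by auto
        then show ?thesis by (simp add: hfold_reflected H_def)
      next
        case 3
        then show ?thesis using c(2)[of h] by (auto simp: H_def)
      qed
    qed
    define X where "X = (\<lambda>j. int j * H) ` {..<r}"
    have "card X \<le> r" unfolding X_def
      using card_image_le[of "{..<r}" "\<lambda>j. int j * H"] by simp
    moreover have "\<exists>x\<in>X. z - x \<in> hfold_sumset h B" if z: "z \<in> hfold_sumset (r * h) B" for z
    proof -
      have "z \<in> {0..int (r * h) * k}" using z hfold_subset by blast
      then have z': "0 \<le> z" "z \<le> int r * H" by (auto simp: H_def)
      show ?thesis
      proof (cases "z = int r * H")
        case True
        then have "z - int (r - 1) * H = H" using assms(1) by (simp add: of_nat_diff algebra_simps)
        then have "z - int (r - 1) * H \<in> hfold_sumset h B" using full Hpos by simp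
        then show ?thesis using assms(1) unfolding X_def
          by (intro bexI[of _ "int (r - 1) * H"] imageI) auto
      next
        case False
        define j where "j = nat (z div H)"
        have j: "int j = z div H" using z' Hpos by (simp add: j_def pos_imp_zdiv_nonneg_iff)
        have zj: "z = int j * H + z mod H" using j by simp
        have m: "0 \<le> z mod H" "z mod H < H" using Hpos by simp_all
        have "int j * H < int r * H" using zj m z' False by linarith
        then have "j < r" using Hpos by simp
        moreover have "z - int j * H \<in> hfold_sumset h B" using zj m by (intro full) auto
        ultimately show ?thesis unfolding X_def by blast
      qed
    qed
    moreover have "finite X" by (simp add: X_def)
    ultimately show "approximate_group r r (hfold_sumset h B)"
      using assms(1) by (intro approximate_group_hfoldI[of r _ X]) auto
  qed
qed

section \<open>Lower bounds\<close>

text \<open>The points \<open>p j\<close> are more than the diameter \<open>H\<close> of \<open>hB\<close> apart, so they belong to distinct translates.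
  When there are no other translates, the start \<open>x j\<close> of the translate that covers \<open>p j\<close>
  has little freedom. If \<open>1 \<notin> B\<close> and some \<open>x j\<close> is too far above its predecessor, then \<open>x j + 1\<close> is
  left uncovered.\<close>

lemma cover_card_lower_bound:
  assumes "r \<ge> 2" "finite X" and cover: "hfold_sumset (r * h) B \<subseteq> hfold_sumset h B + X"
    and c: "c \<ge> 0" "{c..int (r * h) * k - c} \<subseteq> hfold_sumset (r * h) B"
    and large: "int h * k > 2 * c + int r + 1"
  shows "card X \<ge> r" and "1 \<notin> B \<Longrightarrow> card X \<ge> r + 1"
proof -
  define H where "H = int h * k"
  define p where "p j = c + int j * (H + 1)" for j
  have H: "H > 2 * c + int r + 1" using large by (simp add: H_def)
  then have Hpos: "H > 0" using c by linarith
  have p_0: "p 0 = c" by (simp add: p_def)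
  have p_mono: "p i \<le> p j" if "i \<le> j" for i j
    using that Hpos by (simp add: p_def)
  have p_step: "p i + (H + 1) \<le> p j" if "i < j" for i j
  proof -
    have "p (Suc i) \<le> p j" using that by (intro p_mono) simp
    then show ?thesis by (simp add: p_def algebra_simps)
  qed
  have p_top: "p (r - 1) + 1 \<le> int r * H - c"
    using H assms(1) by (simp add: p_def of_nat_diff algebra_simps)
  have covered: "\<exists>x\<in>X. z - x \<in> hfold_sumset h B" if "z \<in> hfold_sumset (r * h) B" for z
    using subsetD[OF cover that] by (force elim: set_plus_elim)
  have mid: "z \<in> hfold_sumset (r * h) B" if "c \<le> z" "z \<le> int r * H - c" for z
    using c(2) that by (auto simp: H_def algebra_simps)
  have bounds: "0 \<le> y" "y \<le> H" if "y \<in> hfold_sumset h B" for y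
    using subsetD[OF hfold_subset that] by (simp_all add: H_def)
  have p_mem: "p j \<in> hfold_sumset (r * h) B" if "j < r" for j
  proof (rule mid)
    show "c \<le> p j" using p_mono[of 0 j] by (simp add: p_def)
    have "p j \<le> p (r - 1)" using that by (intro p_mono) simp
    with p_top show "p j \<le> int r * H - c" by linarith
  qed
  have "\<forall>j\<in>{..<r}. \<exists>x\<in>X. p j - x \<in> hfold_sumset h B" using p_mem covered by blast
  then obtain x where x: "\<And>j. j < r \<Longrightarrow> x j \<in> X"
    "\<And>j. j < r \<Longrightarrow> p j - x j \<in> hfold_sumset h B"
    by (metis lessThan_iff)
  have x_bounds: "x j \<le> p j" "p j \<le> x j + H" if "j < r" for j
    using bounds[OF x(2)[OF that]] by simp_all
  have x_less: "x i < x j" if "i < j" "j < r" for i j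
    using p_step[of i j] x_bounds[of i] x_bounds[of j] that by simp
  have inj: "inj_on x {..<r}"
  proof (rule inj_onI)
    fix i j assume "i \<in> {..<r}" "j \<in> {..<r}" "x i = x j"
    then show "i = j" using x_less[of i j] x_less[of j i] by (cases i j rule: linorder_cases) auto
  qed
  have sub: "x ` {..<r} \<subseteq> X" using x(1) by auto
  have card_x: "card (x ` {..<r}) = r" using inj by (simp add: card_image)
  show ge: "card X \<ge> r" using card_mono[OF assms(2) sub] card_x by simp
  show "card X \<ge> r + 1" if one: "1 \<notin> B"
  proof (rule ccontr)
    assume "\<not> card X \<ge> r + 1"
    with ge card_x have "card X = card (x ` {..<r})" by simp
    then have X: "X = x ` {..<r}" using card_subset_eq[OF assms(2) sub] by simp
    have one': "1 \<notin> hfold_sumset h B" using small_mem[of 1 h 1] one by auto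
    have cov: "\<exists>j<r. 0 \<le> z - x j \<and> z - x j \<le> H \<and> z - x j \<noteq> 1"
      if "z \<in> hfold_sumset (r * h) B" for z
      using covered[OF that] bounds one' unfolding X by fastforce
    have x0: "x 0 \<le> 0"
    proof -
      have "0 \<in> hfold_sumset (r * h) B" using hfold_mono[of 0 "r * h"] by simp
      then obtain j where j: "j < r" "0 \<le> 0 - x j" using cov by blast
      have "j = 0"
      proof (rule ccontr)
        assume "j \<noteq> 0"
        then have "p 0 + (H + 1) \<le> p j" by (intro p_step) simp
        then show False using j x_bounds[of j] c(1) p_0 by linarith
      qed
      with j show ?thesis by simp
    qed
    have xr: "x (r - 1) \<ge> (int r - 1) * H"
    proof -
      have "0 + int (r * h) * k \<in> hfold_sumset (0 + r * h) B"
        by (rule add_multiple_mem) simp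
      then have "int r * H \<in> hfold_sumset (r * h) B" by (simp add: H_def algebra_simps)
      then obtain j where j: "j < r" "int r * H - x j \<le> H" using cov by blast
      have "j = r - 1"
      proof (rule ccontr)
        assume "j \<noteq> r - 1"
        with j have "j \<le> r - 2" by simp
        then have "p j \<le> p (r - 2)" by (rule p_mono)
        also have "p (r - 2) = c + (int r - 2) * (H + 1)"
          using assms(1) by (simp add: p_def of_nat_diff)
        finally show False using j x_bounds[of j] H c by (simp add: algebra_simps)
      qed
      with j show ?thesis by (simp add: algebra_simps)
    qed
    \<comment> \<open>The last index before \<open>r - 1\<close> for which \<open>x i\<close> is not too late. Its successor is late, so their distance is at
      least \<open>H\<close>; maximality also keeps all later translates away from the point \<open>z\<close> below.\<close>
    define I where "I = {i. i < r - 1 \<and> x i \<le> int i * H}"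
    define i where "i = Max I"
    have "finite I" by (simp add: I_def)
    moreover have "0 \<in> I" using x0 assms(1) by (simp add: I_def)
    ultimately have "i \<in> I" and i_max: "\<And>j. j \<in> I \<Longrightarrow> j \<le> i"
      unfolding i_def by (auto intro: Max_in)
    then have i: "i < r - 1" "x i \<le> int i * H" by (auto simp: I_def)
    have above: "x j \<ge> int j * H" if "i < j" "j < r" for j
    proof (cases "j = r - 1")
      case True
      with xr that assms(1) show ?thesis by (simp add: of_nat_diff)
    next
      case False
      have "j \<notin> I" using i_max[of j] that(1) by auto
      moreover have "j < r - 1" using False that(2) by linarith
      ultimately show ?thesis by (simp add: I_def)
    qed
    define z where "z = x (Suc i) + 1"
    have Suc_i: "Suc i < r" using i by simp
    have z_gap: "z \<ge> x i + H + 1" using above[of "Suc i"] i Suc_i by (simp add: z_def algebra_simps)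
    have z_le: "z \<le> p (Suc i) + 1" using x_bounds[OF Suc_i] by (simp add: z_def)
    have "z \<in> hfold_sumset (r * h) B"
    proof (rule mid)
      show "c \<le> z" using z_gap x_bounds(2)[of i] p_mono[of 0 i] Suc_i p_0 by linarith
      have "p (Suc i) \<le> p (r - 1)" using i(1) by (intro p_mono) linarith
      with z_le p_top show "z \<le> int r * H - c" by linarith
    qed
    then obtain j where j: "j < r" "0 \<le> z - x j" "z - x j \<le> H" "z - x j \<noteq> 1"
      using cov by blast
    consider "j \<le> i" | "j = Suc i" | "Suc i < j" by linarith
    then show False
    proof cases
      case 1
      then have "x j \<le> x i" using x_less[of j i] Suc_i by (cases "j = i") auto
      with z_gap j show False by linarith
    next
      case 2
      with j show False by (simp add: z_def)
    next
      case 3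
      then have "x j \<ge> int j * H" using above j by simp
      moreover have "int j * H \<ge> (int i + 2) * H" using 3 Hpos by (intro mult_right_mono) auto
      ultimately have "(int i + 2) * H \<le> p (Suc i) + 1" using j z_le by linarith
      then have "H \<le> c + int i + 2" by (simp add: p_def algebra_simps)
      then show False using H c Suc_i by linarith
    qed
  qed
qed

lemma asymptotic_lower_bound:
  assumes "r \<ge> 2" "asymptotic_approximate_group r l B"
  shows "l \<ge> r" and "1 \<notin> B \<Longrightarrow> l \<ge> r + 1"
proof -
  obtain c where c: "c \<ge> 0" "\<And>h. {c..int h * k - c} \<subseteq> hfold_sumset h B"
    using central_interval by blast
  obtain h0 where h0: "\<And>h. h \<ge> h0 \<Longrightarrow> h > 0 \<Longrightarrow> approximate_group r l (hfold_sumset h B)"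
    using assms(2) unfolding asymptotic_approximate_group_def by blast
  define h where "h = h0 + nat (2 * c + int r + 2)"
  have h: "int h > 2 * c + int r + 1" "h \<ge> h0" "h > 0" using c by (auto simp: h_def)
  moreover have "int h * k \<ge> int h" using k_pos by (simp add: mult_le_cancel_left1)
  ultimately have large: "int h * k > 2 * c + int r + 1" by linarith
  obtain X where X: "finite X" "card X = l" "hfold_sumset (r * h) B \<subseteq> hfold_sumset h B + X"
    using h0[OF h(2,3)] unfolding approximate_group_def hfold_sumset_hfold_sumset by blast
  show "l \<ge> r" "1 \<notin> B \<Longrightarrow> l \<ge> r + 1"
    using cover_card_lower_bound[OF assms(1) X(1,3) c large] X(2) by auto
qed

lemma asymptotic_lower_bound_reflected:
  assumes "r \<ge> 2" "asymptotic_approximate_group r l B" "k - 1 \<notin> B"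
  shows "l \<ge> r + 1"
proof (rule normalized_set.asymptotic_lower_bound(2)[OF reflected assms(1)])
  show "asymptotic_approximate_group r l ((\<lambda>x. k - x) ` B)"
    using assms(2) unfolding reflected_affine
    by (subst asymptotic_approximate_group_affine) auto
  show "1 \<notin> (\<lambda>x. k - x) ` B" using assms(3) by (auto simp: algebra_simps)
qed

lemma covering_number_normalized:
  assumes "r \<ge> 2"
  shows "(\<exists>l>0. asymptotic_approximate_group r l B) \<and>
    asymptotic_covering_number r B = (if 1 \<in> B \<and> k - 1 \<in> B then r else r + 1)"
proof
  show "\<exists>l>0. asymptotic_approximate_group r l B"
    using asymptotic_Suc_r[of r] assms by (intro exI[of _ "r + 1"]) auto
  show "asymptotic_covering_number r B = (if 1 \<in> B \<and> k - 1 \<in> B then r else r + 1)"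
    unfolding asymptotic_covering_number_def
  proof (rule Least_equality)
    show "0 < (if 1 \<in> B \<and> k - 1 \<in> B then r else r + 1) \<and>
      asymptotic_approximate_group r (if 1 \<in> B \<and> k - 1 \<in> B then r else r + 1) B"
      using asymptotic_Suc_r[of r] asymptotic_r[of r] assms by auto
    show "(if 1 \<in> B \<and> k - 1 \<in> B then r else r + 1) \<le> l"
      if "0 < l \<and> asymptotic_approximate_group r l B" for l
      using that asymptotic_lower_bound[OF assms, of l] asymptotic_lower_bound_reflected[OF assms, of l]
      by auto
  qed
qed

end

section \<open>Normalization\<close>

theorem corollary3:
  fixes r m :: nat and a :: "nat \<Rightarrow> int" and A :: "int set" and d :: int
  assumes "r \<ge> 2"
    and "m \<ge> 2"
    and "strict_mono_on {1..m} a"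
    and "A = a ` {1..m}"
    and "d = Gcd ((\<lambda>i. a i - a 1) ` {2..m})"
  shows "(\<exists>l>0. asymptotic_approximate_group r l A) \<and>
    asymptotic_covering_number r A =
      (if a 2 = a 1 + d \<and> a m = a (m - 1) + d then r else r + 1)"
proof -
  have less: "a i < a j" if "1 \<le> i" "i < j" "j \<le> m" for i j
    using assms(3) that by (auto simp: strict_mono_on_def)
  have le: "a i \<le> a j" if "1 \<le> i" "i \<le> j" "j \<le> m" for i j
    using less[of i j] that by (cases "i = j") auto
  have dvd: "d dvd a i - a 1" if "1 \<le> i" "i \<le> m" for i
  proof (cases "i = 1")
    case False
    with that show ?thesis unfolding assms(5) by (intro Gcd_dvd) auto
  qed simp
  have "d \<ge> 0" unfolding assms(5) by simp
  moreover have "d \<noteq> 0" using dvd[of 2] less[of 1 2] assms(2) by auto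
  ultimately have d: "d > 0" by simp
  define b where "b i = (a i - a 1) div d" for i
  have a_b: "a i = a 1 + d * b i" if "1 \<le> i" "i \<le> m" for i
    using dvd[OF that] by (simp add: b_def)
  have b_le: "b i \<le> b j \<longleftrightarrow> a i \<le> a j" if "1 \<le> i" "i \<le> m" "1 \<le> j" "j \<le> m" for i j
    using a_b[of i] a_b[of j] that d by simp
  have b_less: "b i < b j" if "1 \<le> i" "i < j" "j \<le> m" for i j
    using less[OF that] b_le[of j i] that by simp
  define B where "B = b ` {1..m}"
  have A_B: "A = (\<lambda>x. a 1 + d * x) ` B"
    unfolding assms(4) B_def image_image by (intro image_cong refl a_b) auto
  have b1: "b 1 = 0" by (simp add: b_def)
  interpret normalized_set B "b m"
  proof
    show "B \<subseteq> {0..b m}"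
    proof
      fix y assume "y \<in> B"
      then obtain i where "i \<in> {1..m}" "y = b i" by (auto simp: B_def)
      with b_le[of 1 i] b_le[of i m] le[of 1 i] le[of i m] b1 show "y \<in> {0..b m}" by simp
    qed
    show "0 \<in> B" "b m \<in> B" using b1 assms(2) by (auto simp: B_def intro: rev_image_eqI)
    show "b m > 0" using b_less[of 1 m] b1 assms(2) by simp
    have "d * Gcd B dvd d"
    proof (subst (2) assms(5), rule Gcd_greatest)
      fix y assume "y \<in> (\<lambda>i. a i - a 1) ` {2..m}"
      then obtain i where i: "i \<in> {2..m}" "y = a i - a 1" by auto
      then have "y = d * b i" "b i \<in> B" using a_b[of i] by (auto simp: B_def)
      then show "d * Gcd B dvd y" by (simp add: Gcd_dvd)
    qed
    then have "Gcd B dvd 1" using d by (metis dvd_times_left_cancel_iff mult.right_neutral less_irrefl)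
    then show "Gcd B = 1" by (simp add: abs_Gcd_eq zdvd1_eq)
  qed
  have first: "1 \<in> B \<longleftrightarrow> a 2 = a 1 + d"
  proof
    assume "1 \<in> B"
    then obtain i where i: "i \<in> {1..m}" "b i = 1" by (auto simp: B_def)
    then have "i \<ge> 2" using b1 by (cases "i = 1") auto
    then have "b 2 \<le> 1" using i le[of 2 i] b_le[of 2 i] by simp
    moreover have "b 2 > 0" using b_less[of 1 2] b1 assms(2) by simp
    ultimately have "b 2 = 1" by simp
    then show "a 2 = a 1 + d" using a_b[of 2] assms(2) by simp
  next
    assume "a 2 = a 1 + d"
    then have "b 2 = 1" using d by (simp add: b_def)
    then show "1 \<in> B" using assms(2) by (auto simp: B_def intro: rev_image_eqI)
  qed
  have last: "b m - 1 \<in> B \<longleftrightarrow> a m = a (m - 1) + d"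
  proof -
    have "b m - 1 \<in> B \<longleftrightarrow> b m - 1 = b (m - 1)"
    proof
      assume "b m - 1 \<in> B"
      then obtain i where i: "i \<in> {1..m}" "b i = b m - 1" by (auto simp: B_def)
      then have "i \<le> m - 1" by (cases "i = m") auto
      then have "b m - 1 \<le> b (m - 1)" using i le[of i "m - 1"] b_le[of i "m - 1"] by simp
      moreover have "b (m - 1) < b m" using b_less[of "m - 1" m] assms(2) by simp
      ultimately show "b m - 1 = b (m - 1)" by simp
    next
      assume "b m - 1 = b (m - 1)"
      then show "b m - 1 \<in> B" using assms(2) by (auto simp: B_def)
    qed
    also have "\<dots> \<longleftrightarrow> d * b m = d * (b (m - 1) + 1)" using d by auto
    also have "\<dots> \<longleftrightarrow> a m = a (m - 1) + d"
      using a_b[of m] a_b[of "m - 1"] assms(2) by (simp add: algebra_simps)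
    finally show ?thesis .
  qed
  have "asymptotic_approximate_group r l A \<longleftrightarrow> asymptotic_approximate_group r l B" for l
    unfolding A_B using d by (intro asymptotic_approximate_group_affine) simp
  then show ?thesis
    using covering_number_normalized[OF assms(1)]
    unfolding asymptotic_covering_number_def first last by simp
qed

end
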